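(* The function $\mu:\mathbb{G}^0\to[0,\infty)$ that assigns to a generalized iterated function system $\mathcal F$ the Lebesgue measure of its invariant set $\Lambda(\mathcal F)$ is upper semi-continuous with respect to the metric $d_0$ on $\mathbb{G}^0$.
   Context: Let $\bar I$ be the closed unit ball in $\mathbb{R}^q$ and let $H(\bar I)$ be the collection of nonempty compact subsets of $\bar I$ with the Hausdorff metric $\mathrm{Hd}$: $\mathrm{Hd}(A_1,A_2)=\max\{\epsilon_1,\epsilon_2\}$, where $\epsilon_i=\inf\{\epsilon : N_\epsilon(A_i)\supset A_j,\ j\ne i\}$ and $N_\epsilon(A)$ is the $\epsilon$-neighborhood of $A$ in $\bar I$ for the Euclidean distance. A generalized iterated function system is a map $\mathcal F:H(\bar I)\to H(\bar I)$ such that (writing $\mathcal F(x)$ for $\mathcal F(\{x\})$): (i) $\mathcal F(A)=\bigcup_{x\in A}\mathcal F(x)$ for all $A\in H(\bar I)$; (ii) there is $L\in[0,1)$ with $\mathrm{Hd}(\mathcal F(x),\mathcal F(y))\le L|x-y|$ for all $x,y\in\bar I$. Such a map is a contraction of $H(\bar I)$, and $\Lambda(\mathcal F)\in H(\bar I)$ denotes its unique fixed point. $\mathbb{G}^0$ is the space of generalized iterated function systems with the metric $d_0(\mathcal F,\mathcal G)=\max_{x\in\bar I}\mathrm{Hd}(\mathcal F(x),\mathcal G(x))$. *)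

theory Defs
  imports "HOL-Analysis.Analysis"
begin

definition unit_cball :: "(real ^ 'q) set" where
  "unit_cball = cball 0 1"

definition compact_subsets :: "(real ^ 'q) set set" where
  "compact_subsets = {A. A \<subseteq> unit_cball \<and> A \<noteq> {} \<and> compact A}"

text \<open>The neighbourhood is open and taken relative to the closed unit ball.\<close>

definition neighborhood :: "real \<Rightarrow> (real ^ 'q) set \<Rightarrow> (real ^ 'q) set" where
  "neighborhood \<epsilon> A = {y \<in> unit_cball. \<exists>x\<in>A. dist x y < \<epsilon>}"

definition Hd :: "(real ^ 'q) set \<Rightarrow> (real ^ 'q) set \<Rightarrow> real" where
  "Hd A B = max (Inf {\<epsilon>. \<epsilon> > 0 \<and> B \<subseteq> neighborhood \<epsilon> A})
                (Inf {\<epsilon>. \<epsilon> > 0 \<and> A \<subseteq> neighborhood \<epsilon> B})"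

text \<open>
  The systems are maps whose domain is exactly \<open>compact_subsets\<close>; they are represented by
  functions that are undefined elsewhere (\<open>\<rightarrow>\<^sub>E\<close>), so that equality of systems is equality of
  maps on that domain and \<open>gifs_dist\<close> separates points.
\<close>

definition gifs :: "((real ^ 'q) set \<Rightarrow> (real ^ 'q) set) set" where
  "gifs = {F \<in> compact_subsets \<rightarrow>\<^sub>E compact_subsets.
     (\<forall>A\<in>compact_subsets. F A = (\<Union>x\<in>A. F {x})) \<and>
     (\<exists>L. 0 \<le> L \<and> L < 1 \<and>
        (\<forall>x\<in>unit_cball. \<forall>y\<in>unit_cball. Hd (F {x}) (F {y}) \<le> L * norm (x - y)))}"

text \<open>
  The supremum is a maximum: \<open>x \<mapsto> Hd (F {x}) (G {x})\<close> is continuous on the compact unit ball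
  whenever \<open>F\<close> and \<open>G\<close> belong to \<open>gifs\<close>.
\<close>

definition gifs_dist ::
  "((real ^ 'q) set \<Rightarrow> (real ^ 'q) set) \<Rightarrow> ((real ^ 'q) set \<Rightarrow> (real ^ 'q) set) \<Rightarrow> real" where
  "gifs_dist F G = (SUP x\<in>unit_cball. Hd (F {x}) (G {x}))"

definition invariant_set :: "((real ^ 'q) set \<Rightarrow> (real ^ 'q) set) \<Rightarrow> (real ^ 'q) set" where
  "invariant_set F = (THE A. A \<in> compact_subsets \<and> F A = A)"

definition upper_semicontinuous_wrt :: "'a set \<Rightarrow> ('a \<Rightarrow> 'a \<Rightarrow> real) \<Rightarrow> ('a \<Rightarrow> real) \<Rightarrow> bool" where
  "upper_semicontinuous_wrt M d f \<longleftrightarrow>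
     (\<forall>x\<in>M. \<forall>\<epsilon>>0. \<exists>\<delta>>0. \<forall>y\<in>M. d x y < \<delta> \<longrightarrow> f y < f x + \<epsilon>)"

end

theory Submission
  imports Defs
begin

text \<open>
  Let \<open>A\<close> be the invariant set of \<open>F\<close> and \<open>B\<close> that of \<open>G\<close>, let \<open>F\<close> contract by \<open>L < 1\<close>, and let
  \<open>d\<close> bound the Hausdorff distances of \<open>F {x}\<close> and \<open>G {x}\<close>. A point of \<open>B\<close> farthest from \<open>A\<close>, at
  distance \<open>e\<close> say, lies in \<open>G {x}\<close> for some \<open>x \<in> B\<close>. It is within \<open>d\<close> of \<open>F {x}\<close>; and \<open>x\<close> has
  a point \<open>y\<close> of \<open>A\<close> within \<open>e\<close>, so \<open>F {x}\<close> lies within \<open>L * e\<close> of \<open>F {y} \<subseteq> A\<close>. Hence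
  \<open>e \<le> d + L * e\<close>, that is \<open>e \<le> d / (1 - L)\<close> (\<open>fixed_sets_stability\<close>): if \<open>G\<close> is close to \<open>F\<close>,
  then \<open>B\<close> lies in a small neighbourhood of \<open>A\<close>. The bound uses the contraction constant of \<open>F\<close>
  only, so it is uniform in \<open>G\<close>.

  Upper semicontinuity of the measure follows by outer regularity: \<open>A\<close> has an open superset \<open>U\<close>
  of measure less than \<open>measure lebesgue A + \<epsilon>\<close>, and by compactness \<open>U\<close> contains a uniform
  neighbourhood of \<open>A\<close>, hence contains \<open>B\<close>.

  The same estimate with \<open>G = F\<close> and \<open>d = 0\<close> shows that fixed sets are unique. A fixed set is
  obtained as the intersection of the decreasing images \<open>(F ^^ n) unit_cball\<close>
  (\<open>fixed_set_exists\<close>).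
\<close>

lemma compact_unit_cball: "compact (unit_cball :: (real ^ 'q) set)"
  by (simp add: unit_cball_def)

lemma singleton_in_compact_subsets: "x \<in> unit_cball \<Longrightarrow> {x} \<in> compact_subsets"
  by (simp add: compact_subsets_def)

lemma Hd_commute: "Hd A B = Hd B A"
  by (simp add: Hd_def max.commute)

text \<open>
  Any radius above the diameter \<open>2\<close> of the ball would do. The sets of radii in \<open>Hd\<close> have to be
  nonempty for their infima to be meaningful.
\<close>

lemma subset_neighborhood_3:
  assumes "A \<in> compact_subsets" "B \<in> compact_subsets"
  shows "A \<subseteq> neighborhood 3 B"
proof
  fix a assume a: "a \<in> A"
  obtain b where b: "b \<in> B" using assms by (auto simp: compact_subsets_def)
  have "norm a \<le> 1" "norm b \<le> 1" "a \<in> unit_cball"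
    using a b assms by (auto simp: compact_subsets_def unit_cball_def)
  moreover from this have "dist b a < 3"
    using norm_triangle_ineq4[of b a] by (simp add: dist_norm)
  ultimately show "a \<in> neighborhood 3 B"
    using b by (auto simp: neighborhood_def)
qed

lemma Hd_le_3:
  assumes "A \<in> compact_subsets" "B \<in> compact_subsets"
  shows "Hd A B \<le> 3"
proof -
  have "Inf {\<epsilon>. \<epsilon> > 0 \<and> C \<subseteq> neighborhood \<epsilon> D} \<le> 3"
    if "C \<in> compact_subsets" "D \<in> compact_subsets" for C D :: "(real ^ 'a) set"
  proof (rule cInf_lower)
    show "3 \<in> {\<epsilon>. \<epsilon> > 0 \<and> C \<subseteq> neighborhood \<epsilon> D}"
      using subset_neighborhood_3[OF that] by simp
    show "bdd_below {\<epsilon>. \<epsilon> > 0 \<and> C \<subseteq> neighborhood \<epsilon> D}"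
      by (rule bdd_belowI[of _ 0]) auto
  qed
  then show ?thesis using assms by (simp add: Hd_def)
qed

text \<open>
  A nearest point of the compact set \<open>B\<close> lies within every admissible \<open>\<epsilon>\<close>, hence within their
  infimum, although the neighbourhoods are open. So later estimates need no extra slack.
\<close>

lemma ex_dist_le_Hd:
  assumes A: "A \<in> compact_subsets" and B: "B \<in> compact_subsets" and a: "a \<in> A"
  obtains b where "b \<in> B" "dist a b \<le> Hd A B"
proof -
  have "infdist a B \<le> Inf {\<epsilon>. \<epsilon> > 0 \<and> A \<subseteq> neighborhood \<epsilon> B}"
  proof (rule cInf_greatest)
    show "{\<epsilon>. \<epsilon> > 0 \<and> A \<subseteq> neighborhood \<epsilon> B} \<noteq> {}"
      using subset_neighborhood_3[OF A B] by (auto intro!: exI[of _ 3])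
  next
    fix \<epsilon> assume "\<epsilon> \<in> {\<epsilon>. \<epsilon> > 0 \<and> A \<subseteq> neighborhood \<epsilon> B}"
    then obtain b where "b \<in> B" "dist b a < \<epsilon>"
      using a by (auto simp: neighborhood_def)
    then show "infdist a B \<le> \<epsilon>"
      by (metis dist_commute infdist_le2 less_imp_le)
  qed
  then have "infdist a B \<le> Hd A B" by (simp add: Hd_def)
  moreover obtain b where "b \<in> B" "infdist a B = dist a b"
    using B infdist_attains_inf[of B a] by (auto simp: compact_subsets_def compact_imp_closed)
  ultimately show ?thesis using that by simp
qed

lemma gifs_in_compact_subsets:
  "F \<in> gifs \<Longrightarrow> A \<in> compact_subsets \<Longrightarrow> F A \<in> compact_subsets"
  unfolding gifs_def using PiE_mem by blast

lemma gifs_UN: "F \<in> gifs \<Longrightarrow> A \<in> compact_subsets \<Longrightarrow> F A = (\<Union>x\<in>A. F {x})"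
  by (simp add: gifs_def)

lemma gifs_contraction:
  assumes "F \<in> gifs"
  obtains L where "0 \<le> L" "L < 1"
    "\<And>x y. x \<in> unit_cball \<Longrightarrow> y \<in> unit_cball \<Longrightarrow> Hd (F {x}) (F {y}) \<le> L * dist x y"
  using assms unfolding gifs_def dist_norm by blast

text \<open>
  The largest distance \<open>e\<close> from a point of \<open>B\<close> to \<open>A\<close> is attained, and applying the two systems
  once gives \<open>e \<le> d + L * e\<close>. The form with two systems serves both for the perturbation of \<open>F\<close>
  and, with \<open>G = F\<close> and \<open>d = 0\<close>, for uniqueness.
\<close>

lemma fixed_sets_stability:
  assumes F: "F \<in> gifs" and G: "G \<in> gifs" and L: "0 \<le> L" "L < 1"
    and contr: "\<And>x y. x \<in> unit_cball \<Longrightarrow> y \<in> unit_cball \<Longrightarrow> Hd (F {x}) (F {y}) \<le> L * dist x y"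
    and close: "\<And>x. x \<in> unit_cball \<Longrightarrow> Hd (F {x}) (G {x}) \<le> d"
    and A: "A \<in> compact_subsets" "F A = A" and B: "B \<in> compact_subsets" "G B = B"
    and b: "b \<in> B"
  shows "infdist b A \<le> d / (1 - L)"
proof -
  have "compact B" "B \<noteq> {}" "B \<subseteq> unit_cball" using B by (auto simp: compact_subsets_def)
  have "closed A" "A \<noteq> {}" "A \<subseteq> unit_cball"
    using A by (auto simp: compact_subsets_def compact_imp_closed)
  obtain m where m: "m \<in> B" "\<And>c. c \<in> B \<Longrightarrow> infdist c A \<le> infdist m A"
    using continuous_attains_sup[OF \<open>compact B\<close> \<open>B \<noteq> {}\<close>, of "\<lambda>c. infdist c A"]
    using continuous_on_infdist[OF continuous_on_id] by blast
  obtain x where x: "x \<in> B" "m \<in> G {x}"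
    using m(1) gifs_UN[OF G B(1)] B(2) by auto
  obtain y where y: "y \<in> A" "infdist x A = dist x y"
    using infdist_attains_inf[OF \<open>closed A\<close> \<open>A \<noteq> {}\<close>] by blast
  have xy: "x \<in> unit_cball" "y \<in> unit_cball"
    using x y \<open>A \<subseteq> unit_cball\<close> \<open>B \<subseteq> unit_cball\<close> by auto
  then have comp: "F {x} \<in> compact_subsets" "F {y} \<in> compact_subsets" "G {x} \<in> compact_subsets"
    using F G by (auto intro: gifs_in_compact_subsets singleton_in_compact_subsets)
  obtain p where p: "p \<in> F {x}" "dist m p \<le> Hd (G {x}) (F {x})"
    using ex_dist_le_Hd[OF comp(3,1) x(2)] by blast
  obtain q where q: "q \<in> F {y}" "dist p q \<le> Hd (F {x}) (F {y})"
    using ex_dist_le_Hd[OF comp(1,2) p(1)] by blast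
  have "q \<in> A" using q(1) y(1) gifs_UN[OF F A(1)] A(2) by auto
  then have "infdist m A \<le> dist m q" by (rule infdist_le)
  also have "\<dots> \<le> dist m p + dist p q" by (rule dist_triangle)
  also have "\<dots> \<le> d + L * dist x y"
    using p(2) q(2) close[OF xy(1)] contr[OF xy] by (simp add: Hd_commute)
  also have "\<dots> \<le> d + L * infdist m A"
    using m(2)[OF x(1)] y(2) L(1) by (simp add: mult_left_mono)
  finally have "infdist m A \<le> d / (1 - L)"
    using L(2) by (simp add: field_simps)
  with m(2)[OF b] show ?thesis by linarith
qed

lemma gifs_mono:
  assumes "F \<in> gifs" "A \<in> compact_subsets" "B \<in> compact_subsets" "A \<subseteq> B"
  shows "F A \<subseteq> F B"
  using assms(4) by (auto simp: gifs_UN[OF assms(1,2)] gifs_UN[OF assms(1,3)])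

text \<open>
  If \<open>x\<close> is near a point \<open>z\<close> with \<open>y \<in> F {z}\<close>, then \<open>y\<close> is near \<open>F {x}\<close> by the Lipschitz
  condition; in the limit \<open>y\<close> belongs to \<open>F {x}\<close>, which is closed.
\<close>

lemma closed_preimage_point:
  assumes F: "F \<in> gifs"
  shows "closed {x \<in> unit_cball. y \<in> F {x}}"
proof -
  obtain L where L: "0 \<le> L" "L < 1"
    and contr: "\<And>x y. x \<in> unit_cball \<Longrightarrow> y \<in> unit_cball \<Longrightarrow> Hd (F {x}) (F {y}) \<le> L * dist x y"
    using gifs_contraction[OF F] by blast
  have "l \<in> unit_cball \<and> y \<in> F {l}"
    if s: "\<And>n. s n \<in> unit_cball \<and> y \<in> F {s n}" and lim: "s \<longlonglongrightarrow> l" for s l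
  proof
    show l: "l \<in> unit_cball"
      using s lim compact_imp_closed[OF compact_unit_cball] closed_sequentially by blast
    have comp: "F {x} \<in> compact_subsets" if "x \<in> unit_cball" for x
      using that F by (auto intro: gifs_in_compact_subsets singleton_in_compact_subsets)
    have "infdist y (F {l}) \<le> L * dist (s n) l" for n
    proof -
      obtain z where "z \<in> F {l}" "dist y z \<le> Hd (F {s n}) (F {l})"
        using ex_dist_le_Hd comp s l by metis
      then show ?thesis
        using contr[of "s n" l] s[of n] l infdist_le2[of z "F {l}" y "L * dist (s n) l"] by simp
    qed
    moreover have "(\<lambda>n. L * dist (s n) l) \<longlonglongrightarrow> 0"
      using tendsto_mult_left[OF tendsto_dist[OF lim tendsto_const[of l]], of L] by simp
    ultimately have "infdist y (F {l}) \<le> 0"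
      using LIMSEQ_le_const by blast
    then have "infdist y (F {l}) = 0" using infdist_nonneg[of y "F {l}"] by linarith
    then show "y \<in> F {l}"
      using comp[OF l] in_closed_iff_infdist_zero[of "F {l}" y]
      by (auto simp: compact_subsets_def compact_imp_closed)
  qed
  then show ?thesis unfolding closed_sequential_limits by blast
qed

text \<open>
  The images of the whole ball decrease to a set \<open>A\<close> with \<open>F A \<subseteq> A\<close> by monotonicity. For the
  converse, a point \<open>y\<close> of \<open>A\<close> has preimages in every image of the ball; these preimages form
  decreasing nonempty compact sets, so one preimage lies in \<open>A\<close>.
\<close>

lemma fixed_set_exists:
  assumes F: "(F :: (real ^ 'q) set \<Rightarrow> (real ^ 'q) set) \<in> gifs"
  shows "\<exists>A. A \<in> compact_subsets \<and> F A = A"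
proof -
  define K where "K n = (F ^^ n) unit_cball" for n
  have unit: "unit_cball \<in> (compact_subsets :: (real ^ 'q) set set)"
    by (simp add: compact_subsets_def compact_unit_cball) (simp add: unit_cball_def)
  have KC: "K n \<in> compact_subsets" for n
    by (induction n) (auto simp: K_def unit intro: gifs_in_compact_subsets[OF F])
  have K_Suc: "K (Suc n) = F (K n)" for n by (simp add: K_def)
  have "K (Suc n) \<subseteq> K n" for n
  proof (induction n)
    case 0
    show ?case using KC[of "Suc 0"] by (simp add: K_def compact_subsets_def)
  next
    case (Suc n)
    then show ?case using gifs_mono[OF F KC KC] by (metis K_Suc)
  qed
  then have anti: "K n \<subseteq> K m" if "m \<le> n" for m n
    using that by (rule lift_Suc_antimono_le)
  define A where "A = (\<Inter>n. K n)"
  have Kc: "compact (K n)" and Kne: "K n \<noteq> {}" and Ksub: "K n \<subseteq> unit_cball" for n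
    using KC[of n] by (auto simp: compact_subsets_def)
  have "A \<noteq> {}"
    unfolding A_def using compact_nest[of K] Kc Kne anti by blast
  moreover have "compact A"
    unfolding A_def using compact_Inter[of "range K"] Kc by auto
  moreover have "A \<subseteq> unit_cball" using Ksub by (auto simp: A_def)
  ultimately have A: "A \<in> compact_subsets" by (simp add: compact_subsets_def)
  have "F A \<subseteq> A"
  proof -
    have "F A \<subseteq> K n" for n
    proof -
      have "F A \<subseteq> F (K n)" using gifs_mono[OF F A KC] by (auto simp: A_def)
      then show ?thesis using anti[of n "Suc n"] K_Suc by auto
    qed
    then show ?thesis by (auto simp: A_def)
  qed
  moreover have "A \<subseteq> F A"
  proof
    fix y assume y: "y \<in> A"
    define P where "P n = K n \<inter> {x \<in> unit_cball. y \<in> F {x}}" for n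
    have "\<Inter>(range P) \<noteq> {}"
    proof (rule compact_nest)
      fix n
      show "compact (P n)"
        unfolding P_def using Kc closed_preimage_point[OF F] by (rule compact_Int_closed)
      have "y \<in> F (K n)" using y K_Suc by (auto simp: A_def)
      then show "P n \<noteq> {}"
        using Ksub[of n] by (auto simp: P_def gifs_UN[OF F KC])
    next
      fix m n :: nat assume "m \<le> n"
      then show "P n \<subseteq> P m" using anti by (auto simp: P_def)
    qed
    then obtain x where "x \<in> A" "y \<in> F {x}" by (auto simp: P_def A_def)
    then show "y \<in> F A" using gifs_UN[OF F A] by auto
  qed
  ultimately show ?thesis using A by blast
qed

lemma fixed_set_subset:
  assumes F: "F \<in> gifs" and A: "A \<in> compact_subsets" "F A = A"
    and B: "B \<in> compact_subsets" "F B = B"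
  shows "B \<subseteq> A"
proof
  fix b assume b: "b \<in> B"
  obtain L where L: "0 \<le> L" "L < 1"
    and contr: "\<And>x y. x \<in> unit_cball \<Longrightarrow> y \<in> unit_cball \<Longrightarrow> Hd (F {x}) (F {y}) \<le> L * dist x y"
    using gifs_contraction[OF F] by blast
  have "Hd (F {x}) (F {x}) \<le> 0" if "x \<in> unit_cball" for x
    using contr[OF that that] by simp
  then have "infdist b A \<le> 0"
    using fixed_sets_stability[OF F F L contr _ A B b, of 0] by simp
  then have "infdist b A = 0" using infdist_nonneg[of b A] by linarith
  then show "b \<in> A"
    using A in_closed_iff_infdist_zero[of A b]
    by (auto simp: compact_subsets_def compact_imp_closed)
qed

lemma invariant_set:
  assumes "F \<in> gifs"
  shows "invariant_set F \<in> compact_subsets" "F (invariant_set F) = invariant_set F"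
proof -
  have "\<exists>!A. A \<in> compact_subsets \<and> F A = A"
    using fixed_set_exists[OF assms] fixed_set_subset[OF assms] by blast
  from theI'[OF this]
  show "invariant_set F \<in> compact_subsets" "F (invariant_set F) = invariant_set F"
    unfolding invariant_set_def by blast+
qed

lemma Hd_le_gifs_dist:
  assumes "F \<in> gifs" "G \<in> gifs" "x \<in> unit_cball"
  shows "Hd (F {x}) (G {x}) \<le> gifs_dist F G"
  unfolding gifs_dist_def
proof (rule cSUP_upper)
  show "bdd_above ((\<lambda>x. Hd (F {x}) (G {x})) ` unit_cball)"
    using assms by (intro bdd_aboveI2[of _ _ 3] Hd_le_3)
      (auto intro: gifs_in_compact_subsets singleton_in_compact_subsets)
qed (use assms in simp)

text \<open>
  Outer regularity combined with compactness: thin neighbourhoods of a compact set have measure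
  close to that of the set.
\<close>

lemma compact_measure_upper_semicontinuous:
  fixes A :: "'a::euclidean_space set"
  assumes "compact A" "A \<noteq> {}" "\<epsilon> > 0"
  obtains r where "r > 0"
    "\<And>B. compact B \<Longrightarrow> (\<And>b. b \<in> B \<Longrightarrow> infdist b A \<le> r) \<Longrightarrow>
      measure lebesgue B < measure lebesgue A + \<epsilon>"
proof -
  have A: "A \<in> lmeasurable" using assms(1) by (rule lmeasurable_compact)
  obtain U where U: "open U" "A \<subseteq> U" and diff: "U - A \<in> lmeasurable"
      "emeasure lebesgue (U - A) < ennreal \<epsilon>"
    using sets_lebesgue_outer_open[OF fmeasurableD[OF A] assms(3)] by blast
  have "U = A \<union> (U - A)" using U(2) by blast
  then have Um: "U \<in> lmeasurable" using fmeasurable.Un[OF A diff(1)] by simp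
  have "measure lebesgue (U - A) = measure lebesgue U - measure lebesgue A"
    using Um A U(2) by (intro measurable_measure_Diff) (auto simp: fmeasurableD)
  moreover have "measure lebesgue (U - A) < \<epsilon>"
    using diff assms(3) by (simp add: emeasure_eq_measure2 ennreal_less_iff)
  ultimately have Uless: "measure lebesgue U < measure lebesgue A + \<epsilon>" by linarith
  obtain r where r: "r > 0" "(\<Union>x\<in>A. cball x r) \<subseteq> U"
    using compact_subset_open_imp_cball_epsilon_subset[OF assms(1) U] by blast
  show thesis
  proof (rule that[OF r(1)])
    fix B assume B: "compact B" "\<And>b. b \<in> B \<Longrightarrow> infdist b A \<le> r"
    have "B \<subseteq> U"
    proof
      fix b assume b: "b \<in> B"
      obtain a where "a \<in> A" "infdist b A = dist b a"
        using infdist_attains_inf[OF compact_imp_closed[OF assms(1)] assms(2)] by blast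
      then have "b \<in> cball a r" using B(2)[OF b] by (simp add: dist_commute)
      then show "b \<in> U" using r(2) \<open>a \<in> A\<close> by blast
    qed
    then have "measure lebesgue B \<le> measure lebesgue U"
      using B(1) Um by (intro measure_mono_fmeasurable) (auto simp: lmeasurable_compact fmeasurableD)
    then show "measure lebesgue B < measure lebesgue A + \<epsilon>" using Uless by linarith
  qed
qed

theorem theorem1p4:
  shows "upper_semicontinuous_wrt
    (gifs :: ((real ^ 'q) set \<Rightarrow> (real ^ 'q) set) set) gifs_dist
    (\<lambda>F. measure lebesgue (invariant_set F))"
  unfolding upper_semicontinuous_wrt_def
proof (intro ballI allI impI)
  fix F :: "(real ^ 'q) set \<Rightarrow> (real ^ 'q) set" and \<epsilon> :: real
  assume F: "F \<in> gifs" and \<epsilon>: "\<epsilon> > 0"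
  let ?A = "invariant_set F"
  obtain L where L: "0 \<le> L" "L < 1"
    and contr: "\<And>x y. x \<in> unit_cball \<Longrightarrow> y \<in> unit_cball \<Longrightarrow> Hd (F {x}) (F {y}) \<le> L * dist x y"
    using gifs_contraction[OF F] by blast
  have "compact ?A" "?A \<noteq> {}"
    using invariant_set(1)[OF F] by (auto simp: compact_subsets_def)
  then obtain r where r: "r > 0"
    "\<And>B. compact B \<Longrightarrow> (\<And>b. b \<in> B \<Longrightarrow> infdist b ?A \<le> r) \<Longrightarrow>
      measure lebesgue B < measure lebesgue ?A + \<epsilon>"
    using compact_measure_upper_semicontinuous[OF _ _ \<epsilon>] by blast
  show "\<exists>\<delta>>0. \<forall>G\<in>gifs. gifs_dist F G < \<delta> \<longrightarrow>
    measure lebesgue (invariant_set G) < measure lebesgue ?A + \<epsilon>"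
  proof (intro exI[of _ "r * (1 - L)"] conjI ballI impI)
    show "0 < r * (1 - L)" using r(1) L(2) by simp
    fix G :: "(real ^ 'q) set \<Rightarrow> (real ^ 'q) set"
    assume G: "G \<in> gifs" and close: "gifs_dist F G < r * (1 - L)"
    have d: "Hd (F {x}) (G {x}) \<le> r * (1 - L)" if "x \<in> unit_cball" for x
      using Hd_le_gifs_dist[OF F G that] close by linarith
    have "infdist b ?A \<le> r" if "b \<in> invariant_set G" for b
      using fixed_sets_stability[OF F G L contr d invariant_set[OF F] invariant_set[OF G] that] L(2)
      by simp
    moreover have "compact (invariant_set G)"
      using invariant_set(1)[OF G] by (simp add: compact_subsets_def)
    ultimately show "measure lebesgue (invariant_set G) < measure lebesgue ?A + \<epsilon>"
      using r(2) by blast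
  qed
qed

end
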